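(* Let $\tau>0$ and assume: (Slater) there are $\overline\pi\in\Pi$ and $\boldsymbol\xi\in\mathbb R^n$, $\boldsymbol\xi>0$ entrywise, with $U^{\overline\pi}_{\mathbf g}(\rho)-\mathbf b\ge\boldsymbol\xi$; (Strong duality) there is a pair $(\pi_\tau^\star,\boldsymbol\lambda^\star)$, with $\pi_\tau^\star$ optimal for the primal problem and $\boldsymbol\lambda^\star\in\arg\min_{\boldsymbol\lambda\ge0}D(\boldsymbol\lambda)$, such that $V_\tau^\star=D_\tau^\star=L(\pi_\tau^\star,\boldsymbol\lambda^\star)$; (Exploration) there is $d>0$ with $d^\pi_\rho(s)\ge d$ for all $s\in\mathcal S$, $\pi\in\Pi$. Then there exist problem-dependent constants $C_1,C_2>0$ (not depending on $\boldsymbol\lambda$ or $\varepsilon$) such that whenever $\boldsymbol\lambda\ge0$ and $D(\boldsymbol\lambda)-D_\tau^\star\le\varepsilon$, the associated Lagrangian maximizer $\pi_{\boldsymbol\lambda}$ satisfies $$\|\pi_{\boldsymbol\lambda}-\pi_\tau^\star\|_2\le C_1\sqrt\varepsilon,$$ $$|V_\tau^{\pi_{\boldsymbol\lambda}}(\rho)-V_\tau^\star|\le 2\varepsilon+\ell_cC_1C_2\sqrt\varepsilon,$$ $$\max_{i\in[n]}\big[b_i-U_{g_i}^{\pi_{\boldsymbol\lambda}}(\rho)\big]_+\le \ell_cC_1\sqrt\varepsilon,$$ where $\ell_c=\sqrt{|\mathcal A|}/(1-\gamma)^2$.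
   Context: Constrained MDP: finite state space $\mathcal S$, finite action space $\mathcal A$, transition kernel $P(\cdot|s,a)\in\Delta(\mathcal S)$, reward $r:\mathcal S\times\mathcal A\to[0,1]$, utilities $\mathbf g=(g_1,\dots,g_n):\mathcal S\times\mathcal A\to[0,1]^n$, threshold $\mathbf b\in[0,1/(1-\gamma)]^n$, discount $\gamma\in[0,1)$, initial distribution $\rho\in\Delta(\mathcal S)$. A policy is a map $\pi:\mathcal S\to\Delta(\mathcal A)$, viewed as a vector in $\mathbb R^{|\mathcal S||\mathcal A|}$; trajectories satisfy $s_0\sim\rho$, $a_t\sim\pi(\cdot|s_t)$, $s_{t+1}\sim P(\cdot|s_t,a_t)$. $\Pi$ is the class of soft-max policies $\pi_\theta(a|s)=\exp(\theta(s,a))/\sum_{a'}\exp(\theta(s,a'))$, $\theta\in\mathbb R^{|\mathcal S||\mathcal A|}$. $V^\pi(\rho)=\mathbb E[\sum_{t\ge0}\gamma^t r(s_t,a_t)]$, $U^\pi_{g_i}(\rho)=\mathbb E[\sum_{t\ge0}\gamma^t g_i(s_t,a_t)]$, $U^\pi_{\mathbf g}(\rho)=(U^\pi_{g_1}(\rho),\dots,U^\pi_{g_n}(\rho))$, $\mathcal H(\rho,\pi)=\mathbb E[\sum_{t\ge0}-\gamma^t\log\pi(a_t|s_t)]$ (natural log), and $V_\tau^\pi(\rho)=V^\pi(\rho)+\tau\mathcal H(\rho,\pi)$. Discounted state visitation distribution: $d^\pi_\rho(s)=(1-\gamma)\sum_{t\ge0}\gamma^t\Pr(s_t=s\mid\pi,s_0\sim\rho)$.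 Primal problem: $\max_{\pi\in\Pi}V_\tau^\pi(\rho)$ subject to $U^\pi_{\mathbf g}(\rho)\ge\mathbf b$ (entrywise), with an optimal policy $\pi_\tau^\star$ and optimal value $V_\tau^\star=V_\tau^{\pi_\tau^\star}(\rho)$. Lagrangian $L(\pi,\boldsymbol\lambda)=V_\tau^\pi(\rho)+\boldsymbol\lambda^\top(U^\pi_{\mathbf g}(\rho)-\mathbf b)$; dual function $D(\boldsymbol\lambda)=\max_{\pi\in\Pi}L(\pi,\boldsymbol\lambda)$; $\pi_{\boldsymbol\lambda}\in\arg\max_{\pi\in\Pi}L(\pi,\boldsymbol\lambda)$; $D_\tau^\star=\min_{\boldsymbol\lambda\ge0}D(\boldsymbol\lambda)$. $[x]_+=\max\{x,0\}$. "Problem-dependent" means depending only on the CMDP data, $\rho$, $\tau$, $d$, $\overline\pi$ and $\boldsymbol\xi$. *)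

theory Defs
  imports "HOL-Probability.Probability"
begin

record ('s, 'a, 'n :: finite) cmdp =
  kernel :: "'s \<Rightarrow> 'a \<Rightarrow> 's pmf"
  reward :: "'s \<Rightarrow> 'a \<Rightarrow> real"
  util :: "'s \<Rightarrow> 'a \<Rightarrow> real ^ 'n"
  thresh :: "real ^ 'n"
  disc :: real
  init :: "'s pmf"

type_synonym ('s, 'a) policy = "'s \<Rightarrow> 'a pmf"

definition valid_cmdp :: "('s :: finite, 'a :: finite, 'n :: finite) cmdp \<Rightarrow> bool" where
  "valid_cmdp M \<longleftrightarrow>
     0 \<le> disc M \<and> disc M < 1 \<and>
     (\<forall>s a. 0 \<le> reward M s a \<and> reward M s a \<le> 1) \<and>
     (\<forall>s a i. 0 \<le> util M s a $ i \<and> util M s a $ i \<le> 1) \<and>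
     (\<forall>i. 0 \<le> thresh M $ i \<and> thresh M $ i \<le> 1 / (1 - disc M))"

definition softmax_policies :: "('s :: finite, 'a :: finite) policy set" where
  "softmax_policies =
     {\<pi>. \<exists>\<theta> :: 's \<Rightarrow> 'a \<Rightarrow> real. \<forall>s a. pmf (\<pi> s) a = exp (\<theta> s a) / (\<Sum>a'\<in>UNIV. exp (\<theta> s a'))}"

definition policy_vec :: "('s :: finite, 'a :: finite) policy \<Rightarrow> real ^ ('s \<times> 'a)" where
  "policy_vec \<pi> = (\<chi> sa. pmf (\<pi> (fst sa)) (snd sa))"

(* Law of the state-action pair at time t given the pairs at times < t. *)
fun step :: "('s :: finite, 'a :: finite, 'n :: finite) cmdp \<Rightarrow> ('s, 'a) policy \<Rightarrow>
    nat \<Rightarrow> (nat \<Rightarrow> 's \<times> 'a) \<Rightarrow> ('s \<times> 'a) measure" where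
  "step M \<pi> 0 \<omega> =
     measure_pmf (bind_pmf (init M) (\<lambda>s. map_pmf (Pair s) (\<pi> s)))"
| "step M \<pi> (Suc t) \<omega> =
     measure_pmf (bind_pmf (kernel M (fst (\<omega> t)) (snd (\<omega> t))) (\<lambda>s. map_pmf (Pair s) (\<pi> s)))"

(* The law of the whole trajectory on (S x A)^nat, from the Ionescu-Tulcea theorem. *)
definition trajectory :: "('s :: finite, 'a :: finite, 'n :: finite) cmdp \<Rightarrow> ('s, 'a) policy \<Rightarrow>
    (nat \<Rightarrow> 's \<times> 'a) measure" where
  "trajectory M \<pi> =
     projective_family.lim UNIV (Ionescu_Tulcea.CI (step M \<pi>) (\<lambda>_. count_space UNIV))
       (\<lambda>_. count_space UNIV)"

lemma Ionescu_Tulcea_step: "Ionescu_Tulcea (step M \<pi>) (\<lambda>_. count_space UNIV)"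
proof (rule Ionescu_Tulcea.intro)
  fix t
  show "step M \<pi> t \<in> measurable (PiM {0..<t} (\<lambda>_. count_space UNIV))
          (subprob_algebra (count_space UNIV))"
  proof (cases t)
    case 0
    then have "step M \<pi> t = (\<lambda>_. measure_pmf (bind_pmf (init M) (\<lambda>s. map_pmf (Pair s) (\<pi> s))))"
      by auto
    then show ?thesis
      by (simp add: measure_pmf_in_subprob_algebra)
  next
    case (Suc k)
    let ?K = "\<lambda>x. measure_pmf (bind_pmf (kernel M (fst x) (snd x)) (\<lambda>s. map_pmf (Pair s) (\<pi> s)))"
    have "?K \<in> measurable (count_space UNIV) (subprob_algebra (count_space UNIV))"
      by (simp add: measure_pmf_in_subprob_algebra)
    moreover have "(\<lambda>\<omega>. \<omega> k) \<in>
        measurable (PiM {0..<t} (\<lambda>_. count_space UNIV)) (count_space UNIV)"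
      using Suc by (intro measurable_component_singleton) auto
    ultimately have "(\<lambda>\<omega>. ?K (\<omega> k)) \<in> measurable (PiM {0..<t} (\<lambda>_. count_space UNIV))
        (subprob_algebra (count_space UNIV))"
      by (rule measurable_compose[rotated])
    moreover have "step M \<pi> t = (\<lambda>\<omega>. ?K (\<omega> k))"
      using Suc by auto
    ultimately show ?thesis by simp
  qed
next
  fix t \<omega>
  show "prob_space (step M \<pi> t \<omega>)"
    by (cases t) (auto intro: prob_space_measure_pmf)
qed

lemma prob_space_trajectory: "prob_space (trajectory M \<pi>)"
proof -
  interpret Ionescu_Tulcea "step M \<pi>" "\<lambda>_. count_space UNIV"
    by (rule Ionescu_Tulcea_step)
  show ?thesis
    unfolding trajectory_def
  proof
    interpret C: prob_space "CI {}"
      by (rule PF.prob_space_P) auto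
    have "emeasure PF.lim (PF.emb UNIV {} (space (PiM {} (\<lambda>_. count_space UNIV)))) = 1"
      using C.emeasure_space_1 by (subst lim) (auto simp: CI_def simp del: PiM_empty)
    then show "emeasure PF.lim (space PF.lim) = 1"
      by (simp add: PF.space_lim prod_emb_def space_PiM vimage_def restrict_def)
  qed
qed

definition discounted ::
  "('s :: finite, 'a :: finite, 'n :: finite) cmdp \<Rightarrow> ('s, 'a) policy \<Rightarrow> ('s \<Rightarrow> 'a \<Rightarrow> real) \<Rightarrow> real"
  where "discounted M \<pi> f =
    (LINT \<omega>|trajectory M \<pi>. (\<Sum>t. disc M ^ t * f (fst (\<omega> t)) (snd (\<omega> t))))"

definition V where "V M \<pi> = discounted M \<pi> (reward M)"

definition U :: "('s :: finite, 'a :: finite, 'n :: finite) cmdp \<Rightarrow> ('s, 'a) policy \<Rightarrow> real ^ 'n"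
  where "U M \<pi> = (\<chi> i. discounted M \<pi> (\<lambda>s a. util M s a $ i))"

definition entropy where "entropy M \<pi> = discounted M \<pi> (\<lambda>s a. - ln (pmf (\<pi> s) a))"

definition Vreg where "Vreg M \<tau> \<pi> = V M \<pi> + \<tau> * entropy M \<pi>"

definition visitation ::
  "('s :: finite, 'a :: finite, 'n :: finite) cmdp \<Rightarrow> ('s, 'a) policy \<Rightarrow> 's \<Rightarrow> real"
  where "visitation M \<pi> s =
    (1 - disc M) * (\<Sum>t. disc M ^ t *
       measure (trajectory M \<pi>) {\<omega> \<in> space (trajectory M \<pi>). fst (\<omega> t) = s})"

definition primal_optimal ::
  "('s :: finite, 'a :: finite, 'n :: finite) cmdp \<Rightarrow> real \<Rightarrow> ('s, 'a) policy \<Rightarrow> bool"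
  where "primal_optimal M \<tau> \<pi> \<longleftrightarrow>
    is_arg_max (Vreg M \<tau>) (\<lambda>\<pi>. \<pi> \<in> softmax_policies \<and> thresh M \<le> U M \<pi>) \<pi>"

definition Lagr ::
  "('s :: finite, 'a :: finite, 'n :: finite) cmdp \<Rightarrow> real \<Rightarrow> ('s, 'a) policy \<Rightarrow> real ^ 'n \<Rightarrow> real"
  where "Lagr M \<tau> \<pi> lam = Vreg M \<tau> \<pi> + lam \<bullet> (U M \<pi> - thresh M)"

definition Lagr_maximizer ::
  "('s :: finite, 'a :: finite, 'n :: finite) cmdp \<Rightarrow> real \<Rightarrow> real ^ 'n \<Rightarrow> ('s, 'a) policy \<Rightarrow> bool"
  where "Lagr_maximizer M \<tau> lam \<pi> \<longleftrightarrow>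
    is_arg_max (\<lambda>\<pi>. Lagr M \<tau> \<pi> lam) (\<lambda>\<pi>. \<pi> \<in> softmax_policies) \<pi>"

(* The maximum over policies and the minimum over multipliers are rendered as SUP and INF;
   Lagr_maximizer and the argmin in strong_duality supply attainment. *)
definition dual ::
  "('s :: finite, 'a :: finite, 'n :: finite) cmdp \<Rightarrow> real \<Rightarrow> real ^ 'n \<Rightarrow> real"
  where "dual M \<tau> lam = (SUP \<pi>\<in>softmax_policies. Lagr M \<tau> \<pi> lam)"

definition dual_opt :: "('s :: finite, 'a :: finite, 'n :: finite) cmdp \<Rightarrow> real \<Rightarrow> real"
  where "dual_opt M \<tau> = (INF lam\<in>{lam. 0 \<le> lam}. dual M \<tau> lam)"

definition slater ::
  "('s :: finite, 'a :: finite, 'n :: finite) cmdp \<Rightarrow> ('s, 'a) policy \<Rightarrow> real ^ 'n \<Rightarrow> bool"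
  where "slater M \<pi> \<xi> \<longleftrightarrow>
    \<pi> \<in> softmax_policies \<and> (\<forall>i. 0 < \<xi> $ i) \<and> \<xi> \<le> U M \<pi> - thresh M"

definition strong_duality ::
  "('s :: finite, 'a :: finite, 'n :: finite) cmdp \<Rightarrow> real \<Rightarrow> ('s, 'a) policy \<Rightarrow> real ^ 'n \<Rightarrow> bool"
  where "strong_duality M \<tau> \<pi> lam \<longleftrightarrow>
    primal_optimal M \<tau> \<pi> \<and> is_arg_min (dual M \<tau>) (\<lambda>\<mu>. 0 \<le> \<mu>) lam \<and>
    Vreg M \<tau> \<pi> = dual_opt M \<tau> \<and> dual_opt M \<tau> = Lagr M \<tau> \<pi> lam"

definition exploration :: "('s :: finite, 'a :: finite, 'n :: finite) cmdp \<Rightarrow> real \<Rightarrow> bool"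
  where "exploration M d \<longleftrightarrow> 0 < d \<and> (\<forall>\<pi>\<in>softmax_policies. \<forall>s. d \<le> visitation M \<pi> s)"

definition lip_const :: "('s :: finite, 'a :: finite, 'n :: finite) cmdp \<Rightarrow> real"
  where "lip_const M = sqrt (real CARD('a)) / (1 - disc M)\<^sup>2"

end

theory Submission
  imports Defs
begin

text \<open>
  For a fixed multiplier, the Lagrangian is, up to a constant, an entropy-regularized discounted
  return. Let \<open>Q\<close> be the regularized action value of its maximizer \<open>\<pi>\<^sub>\<lambda>\<close>. Passing to the policy
  proportional to \<open>exp (Q / \<tau>)\<close> gains, by the performance difference identity, at least a multiple
  of a relative entropy at every state, since all states are visited; hence \<open>\<pi>\<^sub>\<lambda>\<close> is that policy.
  The same identity then expresses the suboptimality of any other policy as \<open>\<tau> / (1 - \<gamma>)\<close> times the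
  visitation average of its relative entropy to \<open>\<pi>\<^sub>\<lambda>\<close>, which dominates half the squared
  Euclidean distance. Since the optimal primal policy is at most \<open>\<epsilon>\<close>-suboptimal for the
  Lagrangian at \<open>\<lambda>\<close>, this gives the distance bound, and Lipschitz continuity of the utilities the
  bound on the violation. For \<open>\<epsilon> \<le> 1\<close> the Slater policy bounds \<open>\<lambda>\<close> uniformly, which controls
  the value; for \<open>\<epsilon> > 1\<close> the value bound holds trivially because regularized values are bounded.
\<close>

section \<open>One-time marginals of the trajectory law\<close>

primrec state_pmf ::
  "('s :: finite, 'a :: finite, 'n :: finite) cmdp \<Rightarrow> ('s, 'a) policy \<Rightarrow> nat \<Rightarrow> 's pmf"
  where
    "state_pmf M \<pi> 0 = init M"
  | "state_pmf M \<pi> (Suc t) = bind_pmf (state_pmf M \<pi> t) (\<lambda>s. bind_pmf (\<pi> s) (kernel M s))"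

definition sa_pmf ::
  "('s :: finite, 'a :: finite, 'n :: finite) cmdp \<Rightarrow> ('s, 'a) policy \<Rightarrow> nat \<Rightarrow> ('s \<times> 'a) pmf"
  where "sa_pmf M \<pi> t = bind_pmf (state_pmf M \<pi> t) (\<lambda>s. map_pmf (Pair s) (\<pi> s))"

lemma measurable_coordinate [measurable]:
  "(\<lambda>\<omega>. \<omega> t) \<in> trajectory M \<pi> \<rightarrow>\<^sub>M count_space UNIV"
proof -
  interpret Ionescu_Tulcea "step M \<pi>" "\<lambda>_. count_space UNIV"
    by (rule Ionescu_Tulcea_step)
  show ?thesis
    unfolding trajectory_def measurable_cong_sets[OF PF.sets_lim refl]
    by (rule measurable_component_singleton) simp
qed

text \<open>The limit measure agrees on cylinders with the finite-horizon measures
  \<open>C 0 n\<close>, which are built one \<open>step\<close> kernel at a time. This turns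
  integrals of a single coordinate into finite sums.\<close>

lemma distr_trajectory:
  fixes M :: "('s :: finite, 'a :: finite, 'n :: finite) cmdp"
  shows "distr (trajectory M \<pi>) (count_space UNIV) (\<lambda>\<omega>. \<omega> t) = measure_pmf (sa_pmf M \<pi> t)"
proof -
  interpret Ionescu_Tulcea "step M \<pi>" "\<lambda>_. count_space UNIV"
    by (rule Ionescu_Tulcea_step)
  \<comment> \<open>The empty history, the only point of the product over \<open>{0..<0}\<close> and
    the start of every \<open>C 0 n\<close>.\<close>
  let ?u = "\<lambda>_::nat. undefined :: 's \<times> 'a"
  let ?N = "\<lambda>n. PiM {0..<n} (\<lambda>_. count_space (UNIV :: ('s \<times> 'a) set))"
  have u: "?u \<in> space (?N 0)" by (simp add: space_PiM)
  have comp: "(\<lambda>\<omega>. f (\<omega> k)) \<in> borel_measurable (?N (Suc n))" if "k \<le> n"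
    for f :: "'s \<times> 'a \<Rightarrow> ennreal" and k n
    using that by (intro measurable_compose[OF measurable_component_singleton]) auto
  \<comment> \<open>\<open>C 0 (Suc t)\<close> carries the coordinates 0 to \<open>t\<close>, so
    \<open>\<omega> t\<close> is the last one drawn and integrates out against
    \<open>step\<close>.\<close>
  have step: "(\<integral>\<^sup>+\<omega>. f (\<omega> t) \<partial>C 0 (Suc t) ?u) = (\<integral>\<^sup>+\<omega>. (\<integral>\<^sup>+x. f x \<partial>step M \<pi> t \<omega>) \<partial>C 0 t ?u)"
    for f and t
  proof -
    have eP_meas: "C 0 t ?u \<rightarrow>\<^sub>M K = ?N t \<rightarrow>\<^sub>M K" for K :: "(nat \<Rightarrow> 's \<times> 'a) measure measure"
      using measurable_cong_sets[OF sets_C[OF u, of t] refl] by simp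
    have "(\<integral>\<^sup>+\<omega>. f (\<omega> t) \<partial>C 0 (Suc t) ?u) = (\<integral>\<^sup>+\<omega>. (\<integral>\<^sup>+x. f (x t) \<partial>eP t \<omega>) \<partial>C 0 t ?u)"
      using measurable_eP[of t] unfolding C.simps add_0 eP_meas[symmetric]
      by (subst nn_integral_bind[where B="?N (Suc t)"]) (rule comp, auto)
    also have "\<dots> = (\<integral>\<^sup>+\<omega>. (\<integral>\<^sup>+x. f x \<partial>step M \<pi> t \<omega>) \<partial>C 0 t ?u)"
      by (intro nn_integral_cong, subst nn_integral_eP) (auto simp: space_C[OF u] intro: comp)
    finally show ?thesis .
  qed
  have C: "(\<integral>\<^sup>+\<omega>. f (\<omega> t) \<partial>C 0 (Suc t) ?u) = (\<integral>\<^sup>+x. f x \<partial>sa_pmf M \<pi> t)" for f t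
  proof (induction t arbitrary: f)
    case 0
    show ?case
      unfolding step by (simp add: sa_pmf_def nn_integral_return u)
  next
    \<comment> \<open>Markov property: \<open>step M \<pi> (Suc t)\<close> looks only at coordinate
      \<open>t\<close>, so the inner integral is again a function of that coordinate and the
      induction hypothesis, general in \<open>f\<close>, applies.\<close>
    case (Suc t)
    have "(\<integral>\<^sup>+\<omega>. f (\<omega> (Suc t)) \<partial>C 0 (Suc (Suc t)) ?u) =
        (\<integral>\<^sup>+\<omega>. (\<lambda>x. \<integral>\<^sup>+y. f y \<partial>bind_pmf (kernel M (fst x) (snd x)) (\<lambda>s. map_pmf (Pair s) (\<pi> s))) (\<omega> t)
          \<partial>C 0 (Suc t) ?u)"
      unfolding step by (simp del: C.simps)
    also have "\<dots> = (\<integral>\<^sup>+x. f x \<partial>sa_pmf M \<pi> (Suc t))"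
      by (subst Suc.IH) (simp add: sa_pmf_def)
    finally show ?case .
  qed
  show ?thesis
  proof (rule measure_eqI)
    fix A :: "('s \<times> 'a) set"
    let ?X = "{\<omega> \<in> space (?N (Suc t)). \<omega> t \<in> A}"
    have X: "?X \<in> sets (?N (Suc t))"
      by measurable
    have "emeasure (distr (trajectory M \<pi>) (count_space UNIV) (\<lambda>\<omega>. \<omega> t)) A
        = emeasure PF.lim (PF.emb UNIV {0..<Suc t} ?X)"
      using measurable_coordinate[of t M \<pi>]
      by (subst emeasure_distr)
         (auto simp: trajectory_def prod_emb_def space_PiM intro!: arg_cong2[where f=emeasure])
    also have "\<dots> = emeasure (CI {0..<Suc t}) ?X"
      by (rule lim[OF _ X]) simp
    also have "\<dots> = emeasure (C 0 (Suc t) ?u) ?X"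
      unfolding emeasure_CI[OF order_refl X]
        prod_emb_id[OF sets.sets_into_space[OF X, unfolded space_PiM], folded space_PiM] ..
    also have "\<dots> = (\<integral>\<^sup>+\<omega>. indicator ?X \<omega> \<partial>C 0 (Suc t) ?u)"
      using X sets_C[OF u, of "Suc t"] by (simp del: C.simps)
    also have "\<dots> = (\<integral>\<^sup>+\<omega>. indicator A (\<omega> t) \<partial>C 0 (Suc t) ?u)"
      by (intro nn_integral_cong) (auto simp: space_C[OF u] indicator_def simp del: C.simps)
    also have "\<dots> = emeasure (measure_pmf (sa_pmf M \<pi> t)) A"
      unfolding C by simp
    finally show "emeasure (distr (trajectory M \<pi>) (count_space UNIV) (\<lambda>\<omega>. \<omega> t)) A
        = emeasure (measure_pmf (sa_pmf M \<pi> t)) A" .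
  qed simp
qed

section \<open>One-step averages over actions and next states\<close>

definition policy_mean :: "('s, 'a :: finite) policy \<Rightarrow> ('s \<Rightarrow> 'a \<Rightarrow> real) \<Rightarrow> 's \<Rightarrow> real"
  where "policy_mean \<pi> f s = (\<Sum>a\<in>UNIV. pmf (\<pi> s) a * f s a)"

definition next_mean ::
  "('s :: finite, 'a :: finite, 'n :: finite) cmdp \<Rightarrow> ('s \<Rightarrow> real) \<Rightarrow> 's \<Rightarrow> 'a \<Rightarrow> real"
  where "next_mean M h s a = (\<Sum>s'\<in>UNIV. pmf (kernel M s a) s' * h s')"

lemma expectation_finite:
  fixes p :: "'b :: finite pmf" and f :: "'b \<Rightarrow> real"
  shows "measure_pmf.expectation p f = (\<Sum>x\<in>UNIV. pmf p x * f x)"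
  by (subst integral_measure_pmf_real[of UNIV]) (auto simp: mult.commute)

lemma sum_pmf_UNIV: "(\<Sum>x\<in>UNIV. pmf p x) = 1" for p :: "'b :: finite pmf"
  by (rule sum_pmf_eq_1) auto

lemma expectation_bind_finite:
  fixes p :: "'b :: finite pmf" and f :: "'b \<Rightarrow> 'c :: finite pmf" and h :: "'c \<Rightarrow> real"
  shows "measure_pmf.expectation (bind_pmf p f) h =
    (\<Sum>x\<in>UNIV. pmf p x * measure_pmf.expectation (f x) h)"
  by (subst pmf_expectation_bind[of UNIV]) auto

lemma policy_mean_linear:
  "policy_mean \<pi> (\<lambda>s a. f s a + g s a) s = policy_mean \<pi> f s + policy_mean \<pi> g s"
  "policy_mean \<pi> (\<lambda>s a. f s a - g s a) s = policy_mean \<pi> f s - policy_mean \<pi> g s"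
  "policy_mean \<pi> (\<lambda>s a. c * f s a) s = c * policy_mean \<pi> f s"
  "policy_mean \<pi> (\<lambda>s a. k s) s = k s"
  by (simp_all add: policy_mean_def algebra_simps sum.distrib sum_subtractf
      flip: sum_distrib_left) (simp add: sum_pmf_UNIV)

lemma policy_mean_bounds:
  assumes "\<And>a. l \<le> f s a" "\<And>a. f s a \<le> u"
  shows "l \<le> policy_mean \<pi> f s" "policy_mean \<pi> f s \<le> u"
proof -
  have "policy_mean \<pi> (\<lambda>_ _. l) s \<le> policy_mean \<pi> f s"
    "policy_mean \<pi> f s \<le> policy_mean \<pi> (\<lambda>_ _. u) s"
    using assms unfolding policy_mean_def by (auto intro!: sum_mono mult_left_mono)
  then show "l \<le> policy_mean \<pi> f s" "policy_mean \<pi> f s \<le> u"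
    by (simp_all add: policy_mean_linear)
qed

lemma next_mean_bounds:
  assumes "\<And>s. l \<le> h s" "\<And>s. h s \<le> u"
  shows "l \<le> next_mean M h s a" "next_mean M h s a \<le> u"
  using policy_mean_bounds[where f="\<lambda>_. h" and \<pi>="\<lambda>_. kernel M s a" and l=l and u=u] assms
  by (simp_all add: policy_mean_def next_mean_def)

text \<open>Adjoint form of the state recursion: the time shift acts on the function instead of the
  law.\<close>

lemma sum_state_pmf_Suc:
  "(\<Sum>s\<in>UNIV. pmf (state_pmf M \<pi> (Suc t)) s * h s) =
    (\<Sum>s\<in>UNIV. pmf (state_pmf M \<pi> t) s * policy_mean \<pi> (next_mean M h) s)"
  by (simp add: expectation_bind_finite policy_mean_def next_mean_def flip: expectation_finite)

lemma expectation_trajectory: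
  fixes M :: "('s :: finite, 'a :: finite, 'n :: finite) cmdp" and f :: "'s \<Rightarrow> 'a \<Rightarrow> real"
  shows "(LINT \<omega>|trajectory M \<pi>. f (fst (\<omega> t)) (snd (\<omega> t))) =
    (\<Sum>s\<in>UNIV. pmf (state_pmf M \<pi> t) s * policy_mean \<pi> f s)"
proof -
  have "(LINT \<omega>|trajectory M \<pi>. f (fst (\<omega> t)) (snd (\<omega> t))) =
      (LINT x|distr (trajectory M \<pi>) (count_space UNIV) (\<lambda>\<omega>. \<omega> t). f (fst x) (snd x))"
    by (subst integral_distr) auto
  also have "\<dots> = (\<Sum>s\<in>UNIV. pmf (state_pmf M \<pi> t) s * policy_mean \<pi> f s)"
    unfolding distr_trajectory sa_pmf_def expectation_bind_finite
    by (simp add: policy_mean_def flip: expectation_finite)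
  finally show ?thesis .
qed

lemma prob_trajectory_state:
  "measure (trajectory M \<pi>) {\<omega> \<in> space (trajectory M \<pi>). fst (\<omega> t) = s} =
    pmf (state_pmf M \<pi> t) s"
proof -
  have "measure (trajectory M \<pi>) {\<omega> \<in> space (trajectory M \<pi>). fst (\<omega> t) = s} =
      measure (distr (trajectory M \<pi>) (count_space UNIV) (\<lambda>\<omega>. \<omega> t)) (fst -` {s})"
    by (subst measure_distr) (auto intro!: arg_cong2[where f=measure])
  also have "\<dots> = pmf (map_pmf fst (sa_pmf M \<pi> t)) s"
    unfolding distr_trajectory by (simp add: pmf_map)
  also have "map_pmf fst (sa_pmf M \<pi> t) = state_pmf M \<pi> t"
    by (simp add: sa_pmf_def map_bind_pmf map_pmf_comp bind_return_pmf')
  finally show ?thesis .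
qed

lemma sums_policy_mean:
  assumes "\<And>a. (\<lambda>t. c t * x t s a) sums y s a"
  shows "(\<lambda>t. c t * policy_mean \<pi> (x t) s) sums policy_mean \<pi> y s"
  unfolding policy_mean_def sum_distrib_left mult.left_commute[of "c _"]
  by (intro sums_sum sums_mult assms)

lemma sums_next_mean:
  assumes "\<And>s. (\<lambda>t. c t * x t s) sums y s"
  shows "(\<lambda>t. c t * next_mean M (x t) s a) sums next_mean M y s a"
  unfolding next_mean_def sum_distrib_left mult.left_commute[of "c _"]
  by (intro sums_sum sums_mult assms)

section \<open>Discounted returns and the visitation distribution\<close>

locale discounted_cmdp =
  fixes M :: "('s :: finite, 'a :: finite, 'n :: finite) cmdp"
  assumes disc_nonneg: "0 \<le> disc M" and disc_less_1: "disc M < 1"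
begin

lemma summable_disc: "summable (\<lambda>t. disc M ^ t)"
  using disc_nonneg disc_less_1 by (simp add: summable_geometric)

lemma summable_discounted:
  assumes "\<And>t. \<bar>x t\<bar> \<le> B"
  shows "summable (\<lambda>t. disc M ^ t * x t)"
proof (rule summable_comparison_test')
  show "summable (\<lambda>t. disc M ^ t * B)"
    using summable_disc by (rule summable_mult2)
  show "norm (disc M ^ t * x t) \<le> disc M ^ t * B" for t
    using assms[of t] disc_nonneg by (simp add: abs_mult mult_left_mono)
qed

lemma visitation_eq: "visitation M \<pi> s = (1 - disc M) * (\<Sum>t. disc M ^ t * pmf (state_pmf M \<pi> t) s)"
  by (simp add: visitation_def prob_trajectory_state)

lemma summable_state: "summable (\<lambda>t. disc M ^ t * pmf (state_pmf M \<pi> t) s)"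
  by (rule summable_discounted[of _ 1]) (simp add: pmf_le_1)

lemma visitation_nonneg: "0 \<le> visitation M \<pi> s"
  unfolding visitation_eq using disc_nonneg disc_less_1 summable_state
  by (intro mult_nonneg_nonneg suminf_nonneg) auto

lemma visitation_mean:
  "(1 - disc M) * (\<Sum>t. disc M ^ t * (\<Sum>s\<in>UNIV. pmf (state_pmf M \<pi> t) s * h s)) =
    (\<Sum>s\<in>UNIV. visitation M \<pi> s * h s)"
proof -
  have "(\<Sum>t. disc M ^ t * (\<Sum>s\<in>UNIV. pmf (state_pmf M \<pi> t) s * h s)) =
      (\<Sum>t. \<Sum>s\<in>UNIV. disc M ^ t * pmf (state_pmf M \<pi> t) s * h s)"
    by (simp add: sum_distrib_left mult.assoc)
  also have "\<dots> = (\<Sum>s\<in>UNIV. (\<Sum>t. disc M ^ t * pmf (state_pmf M \<pi> t) s) * h s)"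
    by (subst suminf_sum) (auto intro: summable_mult2 summable_state simp: suminf_mult2[OF summable_state])
  finally show ?thesis
    by (simp add: visitation_eq sum_distrib_left mult.assoc)
qed

lemma sum_visitation: "(\<Sum>s\<in>UNIV. visitation M \<pi> s) = 1"
  using visitation_mean[of \<pi> "\<lambda>_. 1"] disc_nonneg disc_less_1
  by (simp add: sum_pmf_UNIV suminf_geometric)

text \<open>On a finite state-action space \<open>f\<close> is bounded, so a geometric series
  dominates the discounted terms and expectation and series may be exchanged. For a fixed policy
  this also covers the reward \<open>- ln (pmf (\<pi> s) a)\<close>.\<close>

lemma discounted_eq_visitation:
  "(1 - disc M) * discounted M \<pi> f = (\<Sum>s\<in>UNIV. visitation M \<pi> s * policy_mean \<pi> f s)"
proof -
  interpret T: prob_space "trajectory M \<pi>" by (rule prob_space_trajectory)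
  define B where "B = (\<Sum>s\<in>UNIV. \<Sum>a\<in>UNIV. \<bar>f s a\<bar>)"
  have B: "\<bar>f s a\<bar> \<le> B" for s a
  proof -
    have "\<bar>f s a\<bar> \<le> (\<Sum>a\<in>UNIV. \<bar>f s a\<bar>)"
      by (rule member_le_sum) auto
    also have "\<dots> \<le> B"
      unfolding B_def by (rule member_le_sum[where f="\<lambda>s. \<Sum>a\<in>UNIV. \<bar>f s a\<bar>"]) (auto intro: sum_nonneg)
    finally show ?thesis .
  qed
  let ?f = "\<lambda>t \<omega>. disc M ^ t * f (fst (\<omega> t)) (snd (\<omega> t))"
  have meas: "?f t \<in> borel_measurable (trajectory M \<pi>)" for t
    by (rule measurable_compose[OF measurable_coordinate[of t]]) simp
  have norm_le: "norm (?f t \<omega>) \<le> disc M ^ t * B" for t \<omega>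
    using B disc_nonneg by (simp add: abs_mult mult_left_mono)
  have int: "integrable (trajectory M \<pi>) (?f t)" for t
    by (rule T.integrable_const_bound[OF AE_I2[OF norm_le] meas])
  have summ: "summable (\<lambda>t. disc M ^ t * B)"
    by (rule summable_mult2[OF summable_disc])
  have "discounted M \<pi> f = (\<Sum>t. LINT \<omega>|trajectory M \<pi>. ?f t \<omega>)"
    unfolding discounted_def
  proof (rule integral_suminf[OF int])
    show "AE \<omega> in trajectory M \<pi>. summable (\<lambda>t. norm (?f t \<omega>))"
      by (intro AE_I2 summable_norm_comparison_test[OF _ summ] exI allI impI norm_le)
    have "(LINT \<omega>|trajectory M \<pi>. norm (?f t \<omega>)) \<le> disc M ^ t * B" for t
      by (intro T.integral_le_const integrable_norm int AE_I2 norm_le)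
    then show "summable (\<lambda>t. LINT \<omega>|trajectory M \<pi>. norm (?f t \<omega>))"
      by (intro summable_comparison_test'[OF summ]) (simp add: integral_nonneg_AE)
  qed
  also have "\<dots> = (\<Sum>t. disc M ^ t * (\<Sum>s\<in>UNIV. pmf (state_pmf M \<pi> t) s * policy_mean \<pi> f s))"
    by (simp add: expectation_trajectory)
  finally show ?thesis
    by (simp add: visitation_mean)
qed

lemma discounted_linear:
  "discounted M \<pi> (\<lambda>s a. f s a + g s a) = discounted M \<pi> f + discounted M \<pi> g"
  "discounted M \<pi> (\<lambda>s a. c * f s a) = c * discounted M \<pi> f"
  "discounted M \<pi> (\<lambda>s a. \<Sum>i\<in>I. F i s a) = (\<Sum>i\<in>I. discounted M \<pi> (F i))"
proof -
  have *: "discounted M \<pi> f = (\<Sum>s\<in>UNIV. visitation M \<pi> s * policy_mean \<pi> f s) / (1 - disc M)" for f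
    using discounted_eq_visitation[of \<pi> f] disc_less_1 by (simp add: field_simps)
  show add: "discounted M \<pi> (\<lambda>s a. f s a + g s a) = discounted M \<pi> f + discounted M \<pi> g" for f g
    by (simp add: * policy_mean_linear algebra_simps sum.distrib add_divide_distrib)
  show "discounted M \<pi> (\<lambda>s a. c * f s a) = c * discounted M \<pi> f"
    by (simp add: * policy_mean_linear sum_distrib_left algebra_simps)
  have zero: "discounted M \<pi> (\<lambda>s a. 0) = 0"
    by (simp add: * policy_mean_def)
  show "discounted M \<pi> (\<lambda>s a. \<Sum>i\<in>I. F i s a) = (\<Sum>i\<in>I. discounted M \<pi> (F i))"
    by (induction I rule: infinite_finite_induct) (simp_all add: zero add)
qed

text \<open>The bounds are imposed on the policy mean rather than on \<open>f\<close>, because the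
  entropy reward has in general no pointwise bound uniform in the policy, while its mean
  does.\<close>

lemma discounted_bounds:
  assumes "\<And>s. l \<le> policy_mean \<pi> f s" "\<And>s. policy_mean \<pi> f s \<le> u"
  shows "l / (1 - disc M) \<le> discounted M \<pi> f" "discounted M \<pi> f \<le> u / (1 - disc M)"
proof -
  have "(\<Sum>s\<in>UNIV. visitation M \<pi> s * l) \<le> (1 - disc M) * discounted M \<pi> f"
    "(1 - disc M) * discounted M \<pi> f \<le> (\<Sum>s\<in>UNIV. visitation M \<pi> s * u)"
    unfolding discounted_eq_visitation
    by (auto intro!: sum_mono mult_left_mono assms visitation_nonneg)
  then show "l / (1 - disc M) \<le> discounted M \<pi> f" "discounted M \<pi> f \<le> u / (1 - disc M)"
    using disc_less_1
    by (simp_all add: sum_distrib_right[symmetric] sum_visitation)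
       (simp_all add: field_simps)
qed

text \<open>The Bellman flow equation. One policy transition moves the average of \<open>h\<close>
  from time \<open>t\<close> to \<open>Suc t\<close>, so the discounted series telescopes to its
  initial term.\<close>

lemma visitation_flow:
  "(\<Sum>s\<in>UNIV. visitation M \<pi> s * (h s - disc M * policy_mean \<pi> (next_mean M h) s)) =
    (1 - disc M) * (\<Sum>s\<in>UNIV. pmf (init M) s * h s)"
proof -
  define x where "x t = (\<Sum>s\<in>UNIV. pmf (state_pmf M \<pi> t) s * h s)" for t
  have "\<bar>x t\<bar> \<le> (\<Sum>s\<in>UNIV. \<bar>h s\<bar>)" for t
    unfolding x_def
    by (rule order_trans[OF sum_abs])
       (auto intro!: sum_mono mult_left_le_one_le simp: abs_mult pmf_le_1)
  then have summ: "summable (\<lambda>t. disc M ^ t * x t)"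
    by (rule summable_discounted)
  have shifted: "(1 - disc M) * (disc M * (\<Sum>t. disc M ^ t * x (Suc t))) =
      (\<Sum>s\<in>UNIV. visitation M \<pi> s * (disc M * policy_mean \<pi> (next_mean M h) s))"
    unfolding x_def sum_state_pmf_Suc mult.left_commute[of _ "disc M"] visitation_mean
    by (simp only: sum_distrib_left)
  have mean: "(1 - disc M) * (\<Sum>t. disc M ^ t * x t) = (\<Sum>s\<in>UNIV. visitation M \<pi> s * h s)"
    by (simp add: x_def visitation_mean)
  have head: "disc M * (\<Sum>t. disc M ^ t * x (Suc t)) = (\<Sum>t. disc M ^ t * x t) - x 0"
  proof -
    have "summable (\<lambda>t. disc M ^ t * x (Suc t))"
      by (rule summable_discounted) fact
    then show ?thesis
      using suminf_split_head[OF summ] by (simp add: suminf_mult[symmetric] mult.assoc)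
  qed
  show ?thesis
    unfolding right_diff_distrib sum_subtractf mean[symmetric] shifted[symmetric] head
    by (simp add: x_def left_diff_distrib right_diff_distrib)
qed

section \<open>State values and the performance difference identity\<close>

text \<open>The value function as the Neumann series of the policy transition operator, which avoids
  a separate trajectory law for each initial state.\<close>

definition state_value :: "('s, 'a) policy \<Rightarrow> ('s \<Rightarrow> 'a \<Rightarrow> real) \<Rightarrow> 's \<Rightarrow> real"
  where "state_value \<pi> f s =
    (\<Sum>t. disc M ^ t * ((\<lambda>h. policy_mean \<pi> (next_mean M h)) ^^ t) (policy_mean \<pi> f) s)"

context
  fixes \<pi> :: "('s, 'a) policy" and f :: "'s \<Rightarrow> 'a \<Rightarrow> real" and l u :: real
  assumes f_ge: "\<And>s a. l \<le> f s a" and f_le: "\<And>s a. f s a \<le> u"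
begin

private abbreviation "iter t \<equiv> ((\<lambda>h. policy_mean \<pi> (next_mean M h)) ^^ t) (policy_mean \<pi> f)"

private lemma iter_bounds: "l \<le> iter t s \<and> iter t s \<le> u"
proof (induction t arbitrary: s)
  case 0
  show ?case using policy_mean_bounds[of l f s u \<pi>, OF f_ge f_le] by simp
next
  case (Suc t)
  have "l \<le> next_mean M (iter t) s a" "next_mean M (iter t) s a \<le> u" for s a
    using next_mean_bounds[of l "iter t" u M s a] Suc.IH by auto
  then show ?case
    using policy_mean_bounds[of l "next_mean M (iter t)" s u \<pi>] by simp
qed

private lemma summable_iter: "summable (\<lambda>t. disc M ^ t * iter t s)"
proof (rule summable_discounted)
  show "\<bar>iter t s\<bar> \<le> max \<bar>l\<bar> \<bar>u\<bar>" for t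
    using iter_bounds[of t s] by linarith
qed

lemma state_value_bounds: "l / (1 - disc M) \<le> state_value \<pi> f s" "state_value \<pi> f s \<le> u / (1 - disc M)"
proof -
  have eq: "(\<Sum>t. disc M ^ t * c) = c / (1 - disc M)" for c
    using suminf_mult2[OF summable_disc, of c] disc_nonneg disc_less_1
    by (simp add: suminf_geometric)
  show "l / (1 - disc M) \<le> state_value \<pi> f s" "state_value \<pi> f s \<le> u / (1 - disc M)"
    unfolding state_value_def eq[symmetric] using iter_bounds disc_nonneg
    by (auto intro!: suminf_le summable_iter summable_mult2 summable_disc mult_left_mono)
qed

lemma state_value_Bellman_bounded:
  "state_value \<pi> f s = policy_mean \<pi> (\<lambda>s a. f s a + disc M * next_mean M (state_value \<pi> f) s a) s"
proof -
  have "(\<lambda>t. disc M ^ t * iter t s) sums state_value \<pi> f s" for s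
    unfolding state_value_def by (rule summable_sums[OF summable_iter])
  \<comment> \<open>Applying the transition operator termwise shifts the series by one index, since
    \<open>funpow\<close> unfolds with the operator outermost.\<close>
  then have "(\<lambda>t. disc M ^ t * iter (Suc t) s) sums policy_mean \<pi> (next_mean M (state_value \<pi> f)) s"
    unfolding funpow.simps o_def by (intro sums_policy_mean sums_next_mean)
  then have "disc M * (\<Sum>t. disc M ^ t * iter (Suc t) s) = disc M * policy_mean \<pi> (next_mean M (state_value \<pi> f)) s"
    and "summable (\<lambda>t. disc M ^ t * iter (Suc t) s)"
    by (auto simp: sums_iff)
  then have "(\<Sum>t. disc M ^ Suc t * iter (Suc t) s) = disc M * policy_mean \<pi> (next_mean M (state_value \<pi> f)) s"
    by (simp only: power_Suc mult.assoc suminf_mult)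
  then show ?thesis
    unfolding policy_mean_linear using suminf_split_head[OF summable_iter, of s]
    by (simp add: state_value_def)
qed

end

lemma state_value_Bellman:
  "state_value \<pi> f s = policy_mean \<pi> (\<lambda>s a. f s a + disc M * next_mean M (state_value \<pi> f) s a) s"
proof (rule state_value_Bellman_bounded)
  let ?f = "\<lambda>x. f (fst x) (snd x)"
  show "Min (range ?f) \<le> f s a" "f s a \<le> Max (range ?f)" for s a
    using rangeI[of ?f "(s, a)"] by simp_all
qed

text \<open>The flow equation for \<open>\<pi>'\<close>, applied to the value function of
  \<open>\<pi>\<close>, leaves a Bellman residual at each state; for \<open>\<pi>\<close> itself the
  residual vanishes. Two rewards \<open>f'\<close> and \<open>f\<close> are allowed because the
  entropy term makes the reward depend on the policy.\<close>

lemma performance_difference: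
  "(1 - disc M) * (discounted M \<pi>' f' - discounted M \<pi> f) =
    (\<Sum>s\<in>UNIV. visitation M \<pi>' s *
      (policy_mean \<pi>' (\<lambda>s a. f' s a + disc M * next_mean M (state_value \<pi> f) s a) s
        - state_value \<pi> f s))"
proof -
  let ?v = "state_value \<pi> f"
  have residual: "(1 - disc M) * (discounted M q g - (\<Sum>s\<in>UNIV. pmf (init M) s * ?v s)) =
      (\<Sum>s\<in>UNIV. visitation M q s *
        (policy_mean q (\<lambda>s a. g s a + disc M * next_mean M ?v s a) s - ?v s))" for q g
    by (subst right_diff_distrib, subst discounted_eq_visitation, subst visitation_flow[of q, symmetric])
       (simp add: policy_mean_linear algebra_simps sum.distrib sum_subtractf)
  have "(1 - disc M) * (discounted M \<pi> f - (\<Sum>s\<in>UNIV. pmf (init M) s * ?v s)) = 0"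
    unfolding residual state_value_Bellman[of \<pi> f, symmetric] by simp
  with disc_less_1 have "discounted M \<pi> f = (\<Sum>s\<in>UNIV. pmf (init M) s * ?v s)"
    by simp
  then show ?thesis
    by (simp only: residual)
qed

end

section \<open>Lipschitz continuity of returns in the policy\<close>

lemma norm_policy_vec_diff:
  fixes \<pi> \<pi>' :: "('s :: finite, 'a :: finite) policy"
  shows "(norm (policy_vec \<pi> - policy_vec \<pi>'))\<^sup>2 =
    (\<Sum>s\<in>UNIV. \<Sum>a\<in>UNIV. (pmf (\<pi> s) a - pmf (\<pi>' s) a)\<^sup>2)"
  unfolding norm_vec_def L2_set_def
  by (simp add: sum_nonneg policy_vec_def sum.cartesian_product case_prod_beta flip: UNIV_Times_UNIV)

text \<open>Cauchy-Schwarz over the actions, the source of \<open>sqrt CARD('a)\<close> in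
  \<open>lip_const\<close>; the block of one state is at most the whole vector.\<close>

lemma sum_abs_pmf_diff_le:
  fixes \<pi> \<pi>' :: "('s :: finite, 'a :: finite) policy"
  shows "(\<Sum>a\<in>UNIV. \<bar>pmf (\<pi> s) a - pmf (\<pi>' s) a\<bar>) \<le>
    sqrt CARD('a) * norm (policy_vec \<pi> - policy_vec \<pi>')"
proof -
  let ?\<Delta> = "\<lambda>s a. pmf (\<pi> s) a - pmf (\<pi>' s) a"
  have "(\<Sum>a\<in>UNIV. (?\<Delta> s a)\<^sup>2) \<le> (\<Sum>s\<in>UNIV. \<Sum>a\<in>UNIV. (?\<Delta> s a)\<^sup>2)"
    by (rule member_le_sum[where f="\<lambda>s. \<Sum>a\<in>UNIV. (?\<Delta> s a)\<^sup>2"]) (auto intro: sum_nonneg)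
  also have "\<dots> = (norm (policy_vec \<pi> - policy_vec \<pi>'))\<^sup>2"
    by (simp add: norm_policy_vec_diff)
  finally have "L2_set (?\<Delta> s) UNIV \<le> norm (policy_vec \<pi> - policy_vec \<pi>')"
    unfolding L2_set_def by (rule real_le_lsqrt[OF norm_ge_zero])
  moreover have "(\<Sum>a\<in>UNIV. \<bar>?\<Delta> s a\<bar>) \<le> sqrt CARD('a) * L2_set (?\<Delta> s) UNIV"
    using L2_set_mult_ineq[of "\<lambda>_. 1" "?\<Delta> s" UNIV] by (simp add: L2_set_def)
  ultimately show ?thesis
    by (meson mult_left_mono order_trans real_sqrt_ge_zero of_nat_0_le_iff)
qed

text \<open>Performance difference with equal rewards: one factor \<open>1 / (1 - disc M)\<close>
  bounds the action value \<open>Q\<close>, the other comes from the normalization of the visitation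
  distribution.\<close>

lemma (in discounted_cmdp) discounted_lipschitz:
  fixes \<pi> \<pi>' :: "('s, 'a) policy"
  assumes f: "\<And>s a. 0 \<le> f s a" "\<And>s a. f s a \<le> 1"
  shows "discounted M \<pi>' f - discounted M \<pi> f \<le>
    lip_const M * norm (policy_vec \<pi>' - policy_vec \<pi>)"
proof -
  let ?\<gamma> = "disc M" and ?v = "state_value \<pi> f"
  let ?N = "norm (policy_vec \<pi>' - policy_vec \<pi>)"
  define Q where "Q s a = f s a + ?\<gamma> * next_mean M ?v s a" for s a
  have \<gamma>: "0 < 1 - ?\<gamma>" using disc_less_1 by simp
  have v: "0 \<le> ?v s" "?v s \<le> 1 / (1 - ?\<gamma>)" for s
    using state_value_bounds[of 0 f 1 \<pi> s] f by auto
  have Q: "\<bar>Q s a\<bar> \<le> 1 / (1 - ?\<gamma>)" for s a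
  proof -
    have n: "0 \<le> next_mean M ?v s a" "next_mean M ?v s a \<le> 1 / (1 - ?\<gamma>)"
      using next_mean_bounds[of 0 ?v "1 / (1 - ?\<gamma>)" M s a] v by auto
    have "Q s a \<le> 1 + ?\<gamma> * (1 / (1 - ?\<gamma>))"
      unfolding Q_def using n f disc_nonneg by (intro add_mono mult_left_mono) auto
    also have "\<dots> = 1 / (1 - ?\<gamma>)" using \<gamma> by (simp add: field_simps)
    finally show ?thesis
      using n(1) f(1)[of s a] disc_nonneg by (simp add: Q_def)
  qed
  have "policy_mean \<pi>' Q s - ?v s \<le> sqrt CARD('a) * ?N / (1 - ?\<gamma>)" for s
  proof -
    have "?v s = policy_mean \<pi> Q s"
      unfolding Q_def by (rule state_value_Bellman)
    then have "policy_mean \<pi>' Q s - ?v s = (\<Sum>a\<in>UNIV. (pmf (\<pi>' s) a - pmf (\<pi> s) a) * Q s a)"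
      by (simp add: policy_mean_def left_diff_distrib sum_subtractf)
    also have "\<dots> \<le> (\<Sum>a\<in>UNIV. \<bar>pmf (\<pi>' s) a - pmf (\<pi> s) a\<bar> * (1 / (1 - ?\<gamma>)))"
    proof (rule sum_mono)
      show "x * Q s a \<le> \<bar>x\<bar> * (1 / (1 - ?\<gamma>))" for x a
        using mult_left_mono[OF Q[of s a], of "\<bar>x\<bar>"] abs_ge_self[of "x * Q s a"]
        by (simp add: abs_mult)
    qed
    also have "\<dots> \<le> sqrt CARD('a) * ?N * (1 / (1 - ?\<gamma>))"
      unfolding sum_distrib_right[symmetric] using \<gamma>
      by (intro mult_right_mono sum_abs_pmf_diff_le) simp
    finally show ?thesis by simp
  qed
  then have "(1 - ?\<gamma>) * (discounted M \<pi>' f - discounted M \<pi> f) \<le>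
      (\<Sum>s\<in>UNIV. visitation M \<pi>' s * (sqrt CARD('a) * ?N / (1 - ?\<gamma>)))"
    unfolding performance_difference Q_def
    by (intro sum_mono mult_left_mono visitation_nonneg)
  also have "\<dots> = sqrt CARD('a) * ?N / (1 - ?\<gamma>)"
    by (simp only: sum_distrib_right[symmetric] sum_visitation mult_1)
  finally have "discounted M \<pi>' f - discounted M \<pi> f \<le> sqrt CARD('a) * ?N / (1 - ?\<gamma>) / (1 - ?\<gamma>)"
    by (simp only: pos_le_divide_eq[OF \<gamma>] mult.commute)
  then show ?thesis
    by (simp add: lip_const_def power2_eq_square)
qed

section \<open>Relative entropy and soft-max policies\<close>

text \<open>The function \<open>x ln x - x\<^sup>2 / 2\<close> is convex on \<open>(0, 1]\<close>, so it lies above its tangent at \<open>q\<close>.\<close>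

lemma mult_ln_divide_ge:
  fixes p q :: real
  assumes "0 < p" "p \<le> 1" "0 < q" "q \<le> 1"
  shows "p - q + (p - q)\<^sup>2 / 2 \<le> p * ln (p / q)"
proof -
  have "(ln q + 1 - q) * (p - q) \<le> (p * ln p - p\<^sup>2 / 2) - (q * ln q - q\<^sup>2 / 2)"
  proof (rule f''_imp_f'[where C="{0<..1}" and f''="\<lambda>x. 1 / x - 1"])
    show "((\<lambda>x. x * ln x - x\<^sup>2 / 2) has_real_derivative ln x + 1 - x) (at x)"
      if "x \<in> {0<..1}" for x
      using that by (auto intro!: derivative_eq_intros)
    show "((\<lambda>x. ln x + 1 - x) has_real_derivative 1 / x - 1) (at x)"
      if "x \<in> {0<..1}" for x
      using that by (auto intro!: derivative_eq_intros)
  qed (use assms in auto)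
  then show ?thesis
    using assms by (simp add: ln_div power2_eq_square field_simps)
qed

text \<open>A Pinsker-type inequality in the Euclidean norm: when the pointwise bounds are summed,
  the linear terms cancel because both masses are one.\<close>

lemma sum_mult_ln_pmf_ge:
  fixes p q :: "'b :: finite pmf"
  assumes "\<And>x. 0 < pmf p x" "\<And>x. 0 < pmf q x"
  shows "(\<Sum>x\<in>UNIV. (pmf p x - pmf q x)\<^sup>2) / 2 \<le> (\<Sum>x\<in>UNIV. pmf p x * ln (pmf p x / pmf q x))"
proof -
  have "(\<Sum>x\<in>UNIV. pmf p x - pmf q x + (pmf p x - pmf q x)\<^sup>2 / 2)
      \<le> (\<Sum>x\<in>UNIV. pmf p x * ln (pmf p x / pmf q x))"
    by (intro sum_mono mult_ln_divide_ge assms pmf_le_1)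
  then show ?thesis
    by (simp add: sum.distrib sum_subtractf sum_pmf_UNIV sum_divide_distrib)
qed

lemma softmax_policies_pos:
  assumes "\<pi> \<in> softmax_policies"
  shows "0 < pmf (\<pi> s) a"
  using assms by (auto simp: softmax_policies_def intro!: divide_pos_pos sum_pos)

text \<open>Puts the Gibbs policy for any action value inside the class over which maximality is
  assumed.\<close>

lemma softmax_policies_exist:
  fixes \<theta> :: "'s :: finite \<Rightarrow> 'a :: finite \<Rightarrow> real"
  obtains \<pi> where "\<pi> \<in> softmax_policies"
    "\<And>s a. pmf (\<pi> s) a = exp (\<theta> s a) / (\<Sum>a'\<in>UNIV. exp (\<theta> s a'))"
proof -
  have "pmf (embed_pmf (\<lambda>a. exp (\<theta> s a) / (\<Sum>a'\<in>UNIV. exp (\<theta> s a')))) a =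
      exp (\<theta> s a) / (\<Sum>a'\<in>UNIV. exp (\<theta> s a'))" for s a
  proof (rule pmf_embed_pmf)
    have pos: "0 < (\<Sum>a'\<in>UNIV. exp (\<theta> s a'))"
      by (rule sum_pos) auto
    show "0 \<le> exp (\<theta> s a) / (\<Sum>a'\<in>UNIV. exp (\<theta> s a'))" for a
      using pos by simp
    have "(\<Sum>a\<in>UNIV. exp (\<theta> s a) / (\<Sum>a'\<in>UNIV. exp (\<theta> s a'))) = 1"
      using pos by (simp flip: sum_divide_distrib)
    then show "(\<integral>\<^sup>+a. ennreal (exp (\<theta> s a) / (\<Sum>a'\<in>UNIV. exp (\<theta> s a'))) \<partial>count_space UNIV) = 1"
      using pos by (simp add: nn_integral_count_space_finite sum_ennreal)
  qed
  then show ?thesis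
    by (intro that[of "\<lambda>s. embed_pmf (\<lambda>a. exp (\<theta> s a) / (\<Sum>a'\<in>UNIV. exp (\<theta> s a')))"])
       (auto simp: softmax_policies_def)
qed

text \<open>Gibbs variational principle: for the policy \<open>q\<close> proportional to \<open>exp (Q / \<tau>)\<close>, the constant
  \<open>c\<close> is \<open>\<tau>\<close> times the log-partition function.\<close>

lemma policy_mean_regularized:
  assumes "\<And>a. 0 < pmf (\<pi> s) a" "\<And>a. 0 < pmf (q s) a" "\<And>a. Q s a = \<tau> * ln (pmf (q s) a) + c"
  shows "policy_mean \<pi> (\<lambda>s a. Q s a + \<tau> * (- ln (pmf (\<pi> s) a))) s =
    c - \<tau> * (\<Sum>a\<in>UNIV. pmf (\<pi> s) a * ln (pmf (\<pi> s) a / pmf (q s) a))"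
proof -
  have "pmf (\<pi> s) a * (Q s a + \<tau> * (- ln (pmf (\<pi> s) a))) =
      pmf (\<pi> s) a * c - \<tau> * (pmf (\<pi> s) a * ln (pmf (\<pi> s) a / pmf (q s) a))" for a
    using assms(1,2)[of a] by (simp add: assms(3) ln_div algebra_simps)
  then have "policy_mean \<pi> (\<lambda>s a. Q s a + \<tau> * (- ln (pmf (\<pi> s) a))) s =
      (\<Sum>a\<in>UNIV. pmf (\<pi> s) a * c - \<tau> * (pmf (\<pi> s) a * ln (pmf (\<pi> s) a / pmf (q s) a)))"
    by (simp only: policy_mean_def)
  then show ?thesis
    by (simp only: sum_subtractf sum_distrib_left[symmetric] sum_distrib_right[symmetric]
        sum_pmf_UNIV mult_1)
qed

section \<open>Quadratic growth of the regularized return\<close>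

context discounted_cmdp
begin

definition regularized :: "real \<Rightarrow> ('s \<Rightarrow> 'a \<Rightarrow> real) \<Rightarrow> ('s, 'a) policy \<Rightarrow> real"
  where "regularized \<tau> R \<pi> = discounted M \<pi> (\<lambda>s a. R s a + \<tau> * (- ln (pmf (\<pi> s) a)))"

text \<open>The suboptimality is an exact visitation average of relative entropies. Exploration
  bounds the weights below by \<open>d\<close>, and the factor 1/2 is that of
  \<open>sum_mult_ln_pmf_ge\<close>.\<close>

lemma regularized_quadratic_growth:
  fixes \<tau> d :: real
  assumes \<tau>: "0 < \<tau>" and expl: "exploration M d"
    and opt: "\<pi>opt \<in> softmax_policies"
      "\<And>\<pi>. \<pi> \<in> softmax_policies \<Longrightarrow> regularized \<tau> R \<pi> \<le> regularized \<tau> R \<pi>opt"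
    and \<pi>: "\<pi> \<in> softmax_policies"
  shows "\<tau> * d / 2 * (norm (policy_vec \<pi> - policy_vec \<pi>opt))\<^sup>2 \<le>
    (1 - disc M) * (regularized \<tau> R \<pi>opt - regularized \<tau> R \<pi>)"
proof -
  define v where "v = state_value \<pi>opt (\<lambda>s a. R s a + \<tau> * (- ln (pmf (\<pi>opt s) a)))"
  \<comment> \<open>The entropy of the current action is left out of \<open>Q\<close>, so the same
    \<open>Q\<close> serves every policy; future entropy enters through \<open>v\<close>.\<close>
  define Q where "Q s a = R s a + disc M * next_mean M v s a" for s a
  let ?Z = "\<lambda>s. \<Sum>a\<in>UNIV. exp (Q s a / \<tau>)"
  obtain q where q: "q \<in> softmax_policies" "\<And>s a. pmf (q s) a = exp (Q s a / \<tau>) / ?Z s"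
    using softmax_policies_exist[of "\<lambda>s a. Q s a / \<tau>"] by metis
  define c where "c s = \<tau> * ln (?Z s)" for s
  define kl where "kl p s = (\<Sum>a\<in>UNIV. pmf (p s) a * ln (pmf (p s) a / pmf (q s) a))"
    for p :: "('s, 'a) policy" and s
  define sq where "sq p s = (\<Sum>a\<in>UNIV. (pmf (p s) a - pmf (q s) a)\<^sup>2)"
    for p :: "('s, 'a) policy" and s
  have Q_eq: "Q s a = \<tau> * ln (pmf (q s) a) + c s" for s a
  proof -
    have "0 < ?Z s" by (rule sum_pos) auto
    then show ?thesis using \<tau> by (simp add: q(2) c_def ln_div field_simps)
  qed
  have kl: "sq p s / 2 \<le> kl p s" if "p \<in> softmax_policies" for p s
    unfolding sq_def kl_def by (intro sum_mult_ln_pmf_ge softmax_policies_pos that q(1))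
  have mean: "policy_mean p (\<lambda>s a. Q s a + \<tau> * (- ln (pmf (p s) a))) s = c s - \<tau> * kl p s"
    if "p \<in> softmax_policies" for p s
    unfolding kl_def by (intro policy_mean_regularized softmax_policies_pos that q(1) Q_eq)
  \<comment> \<open>This is the Bellman equation of \<open>\<pi>opt\<close> read through
    \<open>mean\<close>; in the difference below the log-partition term \<open>c s\<close> then
    cancels.\<close>
  have v: "v s = c s - \<tau> * kl \<pi>opt s" for s
    unfolding mean[OF opt(1), symmetric] Q_def v_def
    by (subst state_value_Bellman) (simp add: algebra_simps)
  have gap: "(1 - disc M) * (regularized \<tau> R p - regularized \<tau> R \<pi>opt) =
      (\<Sum>s\<in>UNIV. visitation M p s * (\<tau> * kl \<pi>opt s - \<tau> * kl p s))"
    if p: "p \<in> softmax_policies" for p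
  proof -
    have "(\<lambda>s a. R s a + \<tau> * (- ln (pmf (p s) a)) + disc M * next_mean M v s a) =
        (\<lambda>s a. Q s a + \<tau> * (- ln (pmf (p s) a)))"
      by (simp add: Q_def fun_eq_iff)
    then show ?thesis
      unfolding regularized_def performance_difference v_def[symmetric]
      by (simp only: mean[OF p] v) simp
  qed
  have d: "0 < d"
    using expl by (simp add: exploration_def)
  have visit: "d \<le> visitation M p s" if "p \<in> softmax_policies" for p s
    using expl that by (simp add: exploration_def)

  \<comment> \<open>Improving \<open>\<pi>opt\<close> to \<open>q\<close> gains nothing, which forces \<open>\<pi>opt = q\<close>.\<close>
  have kl_q: "kl q s = 0" for s
    using softmax_policies_pos[OF q(1), THEN less_imp_neq] by (simp add: kl_def)
  have kl_nonneg: "0 \<le> kl p s" if "p \<in> softmax_policies" for p s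
    using kl[OF that, of s] sum_nonneg[of UNIV "\<lambda>a. (pmf (p s) a - pmf (q s) a)\<^sup>2"]
    by (simp add: sq_def)
  have "(1 - disc M) * (regularized \<tau> R q - regularized \<tau> R \<pi>opt) \<le> 0"
    using opt(2)[OF q(1)] disc_less_1 by (intro mult_nonneg_nonpos) auto
  then have "(\<Sum>s\<in>UNIV. visitation M q s * (\<tau> * kl \<pi>opt s)) \<le> 0"
    unfolding gap[OF q(1)] kl_q by simp
  moreover have terms: "0 \<le> visitation M q s * (\<tau> * kl \<pi>opt s)" for s
    using \<tau> by (intro mult_nonneg_nonneg visitation_nonneg kl_nonneg opt(1)) simp
  ultimately have "(\<Sum>s\<in>UNIV. visitation M q s * (\<tau> * kl \<pi>opt s)) = 0"
    by (simp add: order_antisym sum_nonneg)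
  then have terms_0: "visitation M q s * (\<tau> * kl \<pi>opt s) = 0" for s
    using terms by (simp add: sum_nonneg_eq_0_iff)
  then have kl_opt: "kl \<pi>opt s = 0" for s
    using \<tau> d visit[OF q(1), of s] terms_0[of s] by auto
  have opt_eq: "pmf (\<pi>opt s) a = pmf (q s) a" for s a
  proof -
    have "sq \<pi>opt s = 0"
      using kl[OF opt(1), of s] kl_opt[of s]
      by (intro order_antisym) (simp_all add: sq_def sum_nonneg)
    then show ?thesis
      by (simp add: sq_def sum_nonneg_eq_0_iff)
  qed

  \<comment> \<open>Since \<open>\<pi>opt\<close> and \<open>q\<close> have the same masses,
    \<open>sq \<pi>\<close> measures the distance to \<open>\<pi>opt\<close>, and only
    \<open>kl \<pi>\<close> survives in \<open>gap\<close>.\<close>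
  have "\<tau> * d / 2 * (norm (policy_vec \<pi> - policy_vec \<pi>opt))\<^sup>2 =
      (\<Sum>s\<in>UNIV. d * (\<tau> * (sq \<pi> s / 2)))"
    by (simp add: norm_policy_vec_diff opt_eq sq_def sum_distrib_left sum_divide_distrib mult_ac)
  also have "\<dots> \<le> (\<Sum>s\<in>UNIV. visitation M \<pi> s * (\<tau> * kl \<pi> s))"
    using \<tau>
    by (intro sum_mono mult_mono mult_left_mono kl[OF \<pi>] visit[OF \<pi>] visitation_nonneg)
       (simp_all add: sq_def sum_nonneg)
  also have "\<dots> = - ((1 - disc M) * (regularized \<tau> R \<pi> - regularized \<tau> R \<pi>opt))"
    by (simp add: gap[OF \<pi>] kl_opt sum_negf)
  finally show ?thesis
    by (simp add: algebra_simps)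
qed

section \<open>Objectives as regularized returns, and their bounds\<close>

lemma Vreg_eq_regularized: "Vreg M \<tau> \<pi> = regularized \<tau> (reward M) \<pi>"
  unfolding Vreg_def V_def entropy_def regularized_def by (simp only: discounted_linear)

lemma Lagr_eq_regularized:
  "Lagr M \<tau> \<pi> lam =
    regularized \<tau> (\<lambda>s a. reward M s a + (\<Sum>i\<in>UNIV. lam $ i * util M s a $ i)) \<pi> - lam \<bullet> thresh M"
  unfolding Lagr_def Vreg_def V_def entropy_def regularized_def discounted_linear
  by (simp add: inner_vec_def U_def right_diff_distrib sum_subtractf)

lemma Vreg_bounds:
  fixes \<pi> :: "('s, 'a) policy"
  assumes "valid_cmdp M" "0 < \<tau>" "\<pi> \<in> softmax_policies"
  shows "0 \<le> Vreg M \<tau> \<pi>" "Vreg M \<tau> \<pi> \<le> (1 + \<tau> * CARD('a)) / (1 - disc M)"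
proof -
  note pos = softmax_policies_pos[OF assms(3)]
  have r: "0 \<le> reward M s a" "reward M s a \<le> 1" for s a
    using assms(1) by (auto simp: valid_cmdp_def)
  have ln: "0 \<le> - ln (pmf (\<pi> s) a)" "pmf (\<pi> s) a * (- ln (pmf (\<pi> s) a)) \<le> 1" for s a
  proof -
    show "0 \<le> - ln (pmf (\<pi> s) a)"
      using pos[of s a] by (simp add: pmf_le_1)
    \<comment> \<open>The inequality \<open>ln x \<le> x - 1\<close> at the inverse probability;
      each action then contributes at most one to the mean entropy, whence \<open>CARD('a)\<close>
      in the bound.\<close>
    have "- ln (pmf (\<pi> s) a) \<le> 1 / pmf (\<pi> s) a"
      using ln_le_minus_one[of "1 / pmf (\<pi> s) a"] pos[of s a] by (simp add: ln_div)
    then show "pmf (\<pi> s) a * (- ln (pmf (\<pi> s) a)) \<le> 1"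
      using pos[of s a] by (simp add: field_simps)
  qed
  let ?f = "\<lambda>s a. reward M s a + \<tau> * (- ln (pmf (\<pi> s) a))"
  have lower: "0 \<le> policy_mean \<pi> ?f s" for s
    unfolding policy_mean_def
    using r ln(1) assms(2) by (intro sum_nonneg mult_nonneg_nonneg add_nonneg_nonneg) auto
  have upper: "policy_mean \<pi> ?f s \<le> 1 + \<tau> * CARD('a)" for s
  proof -
    have "policy_mean \<pi> (\<lambda>s a. - ln (pmf (\<pi> s) a)) s \<le> (\<Sum>a\<in>(UNIV :: 'a set). 1)"
      unfolding policy_mean_def by (intro sum_mono ln(2))
    moreover have "policy_mean \<pi> (reward M) s \<le> 1"
      using policy_mean_bounds(2)[of 0 "reward M" s 1 \<pi>] r by simp
    ultimately show ?thesis
      unfolding policy_mean_linear using assms(2) by (intro add_mono mult_left_mono) auto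
  qed
  show "0 \<le> Vreg M \<tau> \<pi>" "Vreg M \<tau> \<pi> \<le> (1 + \<tau> * CARD('a)) / (1 - disc M)"
    using discounted_bounds[where f="?f", OF lower upper]
    by (simp_all add: Vreg_eq_regularized regularized_def)
qed

end

section \<open>From the dual gap to the primal bounds\<close>

lemma dual_eq_Lagr:
  assumes "Lagr_maximizer M \<tau> lam \<pi>"
  shows "dual M \<tau> lam = Lagr M \<tau> \<pi> lam"
  unfolding dual_def using assms
  by (intro cSup_eq_maximum) (auto simp: Lagr_maximizer_def is_arg_max_def not_less)

theorem proposition3p7:
  fixes M :: "('s :: finite, 'a :: finite, 'n :: finite) cmdp"
    and \<tau> d :: real
    and \<pi>bar :: "('s, 'a) policy"
    and \<xi> :: "real ^ 'n"
  assumes "valid_cmdp M"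
    and "0 < \<tau>"
    and "slater M \<pi>bar \<xi>"
    and "exploration M d"
  shows "\<exists>C1 > 0. \<exists>C2 > 0. \<forall>\<pi>opt lamopt. strong_duality M \<tau> \<pi>opt lamopt \<longrightarrow>
    (\<forall>lam \<epsilon> \<pi>lam. 0 \<le> lam \<longrightarrow> dual M \<tau> lam - dual_opt M \<tau> \<le> \<epsilon> \<longrightarrow> Lagr_maximizer M \<tau> lam \<pi>lam \<longrightarrow>
      norm (policy_vec \<pi>lam - policy_vec \<pi>opt) \<le> C1 * sqrt \<epsilon> \<and>
      \<bar>Vreg M \<tau> \<pi>lam - Vreg M \<tau> \<pi>opt\<bar> \<le> 2 * \<epsilon> + lip_const M * C1 * C2 * sqrt \<epsilon> \<and>
      (MAX i. max (thresh M $ i - U M \<pi>lam $ i) 0) \<le> lip_const M * C1 * sqrt \<epsilon>)"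
proof -
  interpret discounted_cmdp M
    using assms(1) by unfold_locales (auto simp: valid_cmdp_def)
  have \<tau>: "0 < \<tau>" by fact
  have d: "0 < d" using assms(4) by (simp add: exploration_def)
  have \<gamma>: "0 < 1 - disc M" using disc_less_1 by simp
  \<comment> \<open>All constants are fixed before \<open>\<pi>opt\<close>, \<open>lam\<close> and
    \<epsilon>. \<open>B\<close> bounds regularized values and \<open>m\<close> is the least Slater
    slack; \<open>C1\<close> solves the quadratic growth bound for the distance. In
    \<open>C2\<close> the first entry bounds the multiplier when \<epsilon> \<le> 1, the second
    ensures \<open>B \<le> C2 * K\<close> for larger \<epsilon>.\<close>
  define B where "B = (1 + \<tau> * CARD('a)) / (1 - disc M)"
  define m where "m = Min (range (\<lambda>i. \<xi> $ i))"
  define C1 where "C1 = sqrt (2 * (1 - disc M) / (\<tau> * d))"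
  define K where "K = lip_const M * C1"
  define C2 where "C2 = max ((B + 1) / m) (B / K)"
  have bar: "\<pi>bar \<in> softmax_policies" "\<And>i. 0 < \<xi> $ i" "\<And>i. \<xi> $ i \<le> U M \<pi>bar $ i - thresh M $ i"
    using assms(3) by (auto simp: slater_def less_eq_vec_def)
  have m: "0 < m" "m \<le> \<xi> $ i" for i
    using bar(2) by (auto simp: m_def)
  have C1: "0 < C1" unfolding C1_def using \<tau> d \<gamma> by simp
  have lip: "0 < lip_const M" unfolding lip_const_def using \<gamma> by simp
  have B: "0 < B" unfolding B_def using \<tau> \<gamma> by (simp add: add_pos_pos)
  have K: "0 < K" unfolding K_def using C1 lip by simp
  have C2: "0 < C2" unfolding C2_def using B m by (simp add: less_max_iff_disj)
  have Vreg: "0 \<le> Vreg M \<tau> \<pi>" "Vreg M \<tau> \<pi> \<le> B" if "\<pi> \<in> softmax_policies" for \<pi> :: "('s, 'a) policy"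
    using Vreg_bounds[OF assms(1) \<tau> that] by (auto simp: B_def)
  have util: "0 \<le> util M s a $ i" "util M s a $ i \<le> 1" for s a i
    using assms(1) by (auto simp: valid_cmdp_def)

  have main: "norm (policy_vec \<pi>lam - policy_vec \<pi>opt) \<le> C1 * sqrt \<epsilon> \<and>
      \<bar>Vreg M \<tau> \<pi>lam - Vreg M \<tau> \<pi>opt\<bar> \<le> 2 * \<epsilon> + lip_const M * C1 * C2 * sqrt \<epsilon> \<and>
      (MAX i. max (thresh M $ i - U M \<pi>lam $ i) 0) \<le> lip_const M * C1 * sqrt \<epsilon>"
    if sd: "strong_duality M \<tau> \<pi>opt lamopt" and lam: "0 \<le> lam"
      and gap: "dual M \<tau> lam - dual_opt M \<tau> \<le> \<epsilon>" and maxi: "Lagr_maximizer M \<tau> lam \<pi>lam"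
    for \<pi>opt \<pi>lam :: "('s, 'a) policy" and lam lamopt :: "real ^ 'n" and \<epsilon>
  proof -
    have opt: "\<pi>opt \<in> softmax_policies" "\<And>i. thresh M $ i \<le> U M \<pi>opt $ i"
        "dual_opt M \<tau> = Vreg M \<tau> \<pi>opt"
      using sd by (auto simp: strong_duality_def primal_optimal_def is_arg_max_def less_eq_vec_def)
    have \<pi>lam: "\<pi>lam \<in> softmax_policies"
      and max: "\<And>\<pi>. \<pi> \<in> softmax_policies \<Longrightarrow> Lagr M \<tau> \<pi> lam \<le> Lagr M \<tau> \<pi>lam lam"
      using maxi by (auto simp: Lagr_maximizer_def is_arg_max_def not_less)
    have lam_i: "0 \<le> lam $ i" for i
      using lam by (simp add: less_eq_vec_def)
    have dual: "Lagr M \<tau> \<pi>lam lam - Vreg M \<tau> \<pi>opt \<le> \<epsilon>"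
      using gap opt(3) dual_eq_Lagr[OF maxi] by simp
    have slack: "0 \<le> lam \<bullet> (U M \<pi>opt - thresh M)"
      unfolding inner_vec_def using lam_i opt(2) by (intro sum_nonneg) simp
    \<comment> \<open>Approximate complementary slackness: \<open>Lagr M \<tau> \<pi>opt lam\<close>
      exceeds \<open>Vreg M \<tau> \<pi>opt\<close> by the slack term, yet is at most the dual
      value, which is within \<epsilon> of \<open>Vreg M \<tau> \<pi>opt\<close>.\<close>
    have \<epsilon>: "0 \<le> \<epsilon>" and slack_le: "lam \<bullet> (U M \<pi>opt - thresh M) \<le> \<epsilon>"
      using max[OF opt(1)] dual slack by (auto simp: Lagr_def)

    let ?N = "norm (policy_vec \<pi>lam - policy_vec \<pi>opt)"
    have "\<tau> * d / 2 * ?N\<^sup>2 \<le> (1 - disc M) * (Lagr M \<tau> \<pi>lam lam - Lagr M \<tau> \<pi>opt lam)"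
      using regularized_quadratic_growth[OF \<tau> assms(4) \<pi>lam, of
          "\<lambda>s a. reward M s a + (\<Sum>i\<in>UNIV. lam $ i * util M s a $ i)" \<pi>opt] max opt(1)
      by (simp add: Lagr_eq_regularized norm_minus_commute)
    \<comment> \<open>The slack term is nonnegative, so \<open>\<pi>opt\<close> is
      \<epsilon>-suboptimal for the Lagrangian at \<open>lam\<close>.\<close>
    also have "\<dots> \<le> (1 - disc M) * \<epsilon>"
      using dual slack \<gamma> by (intro mult_left_mono) (auto simp: Lagr_def)
    finally have "?N\<^sup>2 \<le> C1\<^sup>2 * \<epsilon>"
      unfolding C1_def using \<tau> d \<gamma> by (simp add: field_simps)
    then have N: "?N \<le> C1 * sqrt \<epsilon>"
      using real_le_rsqrt[of ?N "C1\<^sup>2 * \<epsilon>"] C1 by (simp add: real_sqrt_mult)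

    have "lip_const M * ?N \<le> K * sqrt \<epsilon>"
      using mult_left_mono[OF N, of "lip_const M"] lip by (simp add: K_def mult.assoc)
    then have U: "U M \<pi>opt $ i - U M \<pi>lam $ i \<le> K * sqrt \<epsilon>"
        "U M \<pi>lam $ i - U M \<pi>opt $ i \<le> K * sqrt \<epsilon>" for i
      using discounted_lipschitz[of "\<lambda>s a. util M s a $ i" \<pi>opt \<pi>lam]
        discounted_lipschitz[of "\<lambda>s a. util M s a $ i" \<pi>lam \<pi>opt] util
      by (auto simp: U_def norm_minus_commute)
    have violation: "(MAX i. max (thresh M $ i - U M \<pi>lam $ i) 0) \<le> K * sqrt \<epsilon>"
    proof (rule Max.boundedI)
      fix x assume "x \<in> range (\<lambda>i. max (thresh M $ i - U M \<pi>lam $ i) 0)"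
      then obtain i where "x = max (thresh M $ i - U M \<pi>lam $ i) 0" by auto
      then show "x \<le> K * sqrt \<epsilon>"
        using opt(2)[of i] U(1)[of i] K \<epsilon> by auto
    qed auto

    have "\<bar>Vreg M \<tau> \<pi>lam - Vreg M \<tau> \<pi>opt\<bar> \<le> 2 * \<epsilon> + C2 * (K * sqrt \<epsilon>)"
    proof (cases "\<epsilon> \<le> 1")
      case True
      define \<Lambda> where "\<Lambda> = (\<Sum>i\<in>UNIV. lam $ i)"
      \<comment> \<open>At the Slater policy the Lagrangian is at least
        \<open>\<Lambda> * m\<close>, as regularized values are nonnegative; by maximality it is at
        most the dual value, which is at most \<open>B + 1\<close> when \<epsilon> \<le> 1.\<close>
      have "\<Lambda> * m \<le> lam \<bullet> (U M \<pi>bar - thresh M)"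
        unfolding \<Lambda>_def sum_distrib_right inner_vec_def inner_real_def
        using order_trans[OF m(2) bar(3)] lam_i by (auto intro!: sum_mono mult_left_mono)
      also have "\<dots> \<le> B + 1"
        using max[OF bar(1)] dual Vreg[OF bar(1)] Vreg[OF opt(1)] True by (simp add: Lagr_def)
      finally have "\<Lambda> \<le> (B + 1) / m"
        using m by (simp add: pos_le_divide_eq)
      then have \<Lambda>: "\<Lambda> \<le> C2" by (simp add: C2_def)
      have "\<bar>lam \<bullet> (U M \<pi>lam - U M \<pi>opt)\<bar> \<le> (\<Sum>i\<in>UNIV. lam $ i * (K * sqrt \<epsilon>))"
        unfolding inner_vec_def inner_real_def
      proof (rule order_trans[OF sum_abs sum_mono])
        show "\<bar>lam $ i * (U M \<pi>lam - U M \<pi>opt) $ i\<bar> \<le> lam $ i * (K * sqrt \<epsilon>)" for i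
          using lam_i[of i] U[of i] by (simp add: abs_mult mult_left_mono)
      qed
      also have "\<dots> \<le> C2 * (K * sqrt \<epsilon>)"
        unfolding sum_distrib_right[symmetric] \<Lambda>_def[symmetric]
        using \<Lambda> K \<epsilon> by (intro mult_right_mono) auto
      finally have "\<bar>lam \<bullet> (U M \<pi>lam - U M \<pi>opt)\<bar> \<le> C2 * (K * sqrt \<epsilon>)" .
      \<comment> \<open>Removing the multiplier term from the Lagrangian costs a Lipschitz part and
        the slack of \<open>\<pi>opt\<close>, which lies between 0 and \<epsilon>; the dual gap
        accounts for at most one further \<epsilon>.\<close>
      moreover have "lam \<bullet> (U M \<pi>lam - thresh M) =
          lam \<bullet> (U M \<pi>lam - U M \<pi>opt) + lam \<bullet> (U M \<pi>opt - thresh M)"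
        by (simp add: inner_diff_right)
      ultimately show ?thesis
        using dual max[OF opt(1)] slack slack_le \<epsilon> by (auto simp: Lagr_def abs_le_iff)
    next
      case False
      \<comment> \<open>Here the Slater bound on the multiplier would grow with \<epsilon>, so the
        range of regularized values, between 0 and \<open>B\<close>, is used instead.\<close>
      have "\<bar>Vreg M \<tau> \<pi>lam - Vreg M \<tau> \<pi>opt\<bar> \<le> B"
        using Vreg[OF \<pi>lam] Vreg[OF opt(1)] by linarith
      also have "B \<le> C2 * K"
        using K by (simp add: C2_def flip: pos_divide_le_eq)
      also have "\<dots> \<le> C2 * K * sqrt \<epsilon>"
        using False C2 K by simp
      also have "\<dots> \<le> 2 * \<epsilon> + C2 * (K * sqrt \<epsilon>)"
        using \<epsilon> by (simp add: mult.assoc)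
      finally show ?thesis .
    qed
    with N violation show ?thesis
      by (simp add: K_def mult_ac)
  qed
  show ?thesis
    using C1 C2 main by blast
qed

end
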